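(* (Validity of superdense coding.) Let $\mathcal{C}$ be a dagger compact closed category with dagger biproducts, let $Q$ be an object of $\mathcal{C}$ and let $\beta_1,\beta_2,\beta_3,\beta_4\colon Q\to Q$ be unitary arrows such that $\mathrm{Tr}(\beta_i\circ\beta_j^\dagger)=0_{I,I}$ whenever $i\neq j$, and $\mathrm{Tr}(\mathbf{1}_Q)\neq0_{I,I}$. Then the composite $$I\xrightarrow{\ \ulcorner\mathbf{1}_Q\urcorner\ }Q^\ast\otimes Q\xrightarrow{\ \langle(\beta_i)_\ast\rangle_{i=1}^{4}\otimes\mathbf{1}_Q\ }(4\cdot Q^\ast)\otimes Q\xrightarrow{\ (4\cdot\sigma_{Q^\ast,Q})\circ\upsilon\ }4\cdot(Q\otimes Q^\ast)\xrightarrow{\ 4\cdot\langle\llcorner\beta_j\lrcorner\rangle_{j=1}^{4}\ }4\cdot(4\cdot I)\cong16\cdot I$$ is equal to the arrow $\Xi\colon I\to16\cdot I$ whose component with index $4(i-1)+j$ is $\mathrm{Tr}(\beta_i\circ\beta_j^\dagger)$, for $1\le i,j\le4$.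
   Context: A compact closed category is a symmetric monoidal category with natural isomorphisms $\alpha_{a,b,c}\colon a\otimes(b\otimes c)\to(a\otimes b)\otimes c$, $\lambda_a\colon I\otimes a\to a$, $\sigma_{a,b}\colon a\otimes b\to b\otimes a$, in which every object $a$ has a dual $a^\ast$ with $\eta_a\colon I\to a^\ast\otimes a$ and $\varepsilon_a\colon a\otimes a^\ast\to I$ satisfying $(a^\ast\otimes\varepsilon_a)\circ\alpha^{-1}_{a^\ast,a,a^\ast}\circ(\eta_a\otimes a^\ast)=\sigma_{I,a^\ast}$ and $(\varepsilon_a\otimes a)\circ\alpha_{a,a^\ast,a}\circ(a\otimes\eta_a)=\sigma_{a,I}$. It is dagger compact closed if it has an identity-on-objects involutive functor $\dagger\colon\mathcal{C}\to\mathcal{C}^{\mathrm{op}}$ with $(f\otimes g)^\dagger=f^\dagger\otimes g^\dagger$, $\alpha^\dagger=\alpha^{-1}$, $\lambda^\dagger=\lambda^{-1}$, $\sigma_{a,b}^\dagger=\sigma_{b,a}$, $\varepsilon_a^\dagger=\sigma_{a^\ast,a}\circ\eta_a$. Biproducts are dagger biproducts if $(\pi^i)^\dagger=\iota^i$. $0_{I,I}$ is the zero arrow $I\to0\to I$. An arrow $f$ is unitary if $f^\dagger$ is its two-sided inverse. For $f\colon a\to b$: the name is $\ulcorner f\urcorner=(a^\ast\otimes f)\circ\eta_a\colon I\to a^\ast\otimes b$; the coname is $\llcorner f\lrcorner=\varepsilon_b\circ(f\otimes b^\ast)\colon a\otimes b^\ast\to I$; $f^\ast\colon b^\ast\to a^\ast$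 is $\lambda_{a^\ast}\circ\sigma_{a^\ast,I}\circ(a^\ast\otimes\varepsilon_b)\circ\alpha^{-1}_{a^\ast,b,b^\ast}\circ((a^\ast\otimes f)\otimes b^\ast)\circ(\eta_a\otimes b^\ast)\circ\lambda^{-1}_{b^\ast}$; and $f_\ast=(f^\dagger)^\ast\colon a^\ast\to b^\ast$. For $f\colon a\to a$, $\mathrm{Tr}(f)=\varepsilon_a\circ(f\otimes a^\ast)\circ\sigma_{a^\ast,a}\circ\eta_a\colon I\to I$. $n\cdot a$ and $n\cdot f$ denote the $n$-fold biproducts, associated to the left, of an object $a$ and an arrow $f$; $\langle f_i\rangle$ is the arrow into the biproduct with components $f_i$. $\upsilon\colon(4\cdot Q^\ast)\otimes Q\to4\cdot(Q^\ast\otimes Q)$ is the distributivity isomorphism with $i$-th component $\pi^i\otimes\mathbf{1}_Q$. The isomorphism $4\cdot(4\cdot I)\cong16\cdot I$ is the canonical one under which the $j$-th component of the $i$-th summand becomes the component with index $4(i-1)+j$. *)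

theory Defs
  imports Main
begin

section \<open>Categories\<close>

text \<open>
  A category has a set of objects and a set of arrows inside arbitrary types; operations are
  constrained on these carriers only.  Composition \<open>g \<cdot> f\<close> is in applicative order.
\<close>

record ('o, 'm) category_data =
  Obj :: "'o set"
  Arr :: "'m set"
  Dom :: "'m \<Rightarrow> 'o"
  Cod :: "'m \<Rightarrow> 'o"
  Ident :: "'o \<Rightarrow> 'm" ("\<one>\<index>")
  Comp :: "'m \<Rightarrow> 'm \<Rightarrow> 'm" (infixr "\<cdot>\<index>" 65)

definition hom :: "('o, 'm, 'x) category_data_scheme \<Rightarrow> 'o \<Rightarrow> 'o \<Rightarrow> 'm set" where
  "hom C a b = {f \<in> Arr C. Dom C f = a \<and> Cod C f = b}"

locale category =
  fixes C (structure)
  assumes Dom_in_Obj: "f \<in> Arr C \<Longrightarrow> Dom C f \<in> Obj C"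
    and Cod_in_Obj: "f \<in> Arr C \<Longrightarrow> Cod C f \<in> Obj C"
    and Ident_in_hom: "a \<in> Obj C \<Longrightarrow> \<one> a \<in> hom C a a"
    and Comp_in_hom: "\<lbrakk>f \<in> hom C a b; g \<in> hom C b c\<rbrakk> \<Longrightarrow> g \<cdot> f \<in> hom C a c"
    and Comp_assoc: "\<lbrakk>f \<in> hom C a b; g \<in> hom C b c; h \<in> hom C c d\<rbrakk>
      \<Longrightarrow> (h \<cdot> g) \<cdot> f = h \<cdot> (g \<cdot> f)"
    and Ident_left: "f \<in> hom C a b \<Longrightarrow> \<one> b \<cdot> f = f"
    and Ident_right: "f \<in> hom C a b \<Longrightarrow> f \<cdot> \<one> a = f"

definition inverse_arrows :: "('o, 'm, 'x) category_data_scheme \<Rightarrow> 'm \<Rightarrow> 'm \<Rightarrow> bool" where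
  "inverse_arrows C f g \<longleftrightarrow>
     f \<in> Arr C \<and> g \<in> hom C (Cod C f) (Dom C f) \<and>
     g \<cdot>\<^bsub>C\<^esub> f = \<one>\<^bsub>C\<^esub> (Dom C f) \<and> f \<cdot>\<^bsub>C\<^esub> g = \<one>\<^bsub>C\<^esub> (Cod C f)"

definition is_iso :: "('o, 'm, 'x) category_data_scheme \<Rightarrow> 'm \<Rightarrow> bool" where
  "is_iso C f \<longleftrightarrow> (\<exists>g. inverse_arrows C f g)"

definition inv_arr :: "('o, 'm, 'x) category_data_scheme \<Rightarrow> 'm \<Rightarrow> 'm" where
  "inv_arr C f = (THE g. inverse_arrows C f g)"


section \<open>Symmetric monoidal categories\<close>

text \<open>
  The tensor is \<open>\<otimes>\<close> on objects and \<open>\<boxtimes>\<close> on arrows.  There is no separate right unitor: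
  its role is played by \<open>\<ell> a \<cdot> \<sigma> a I\<close>.
\<close>

record ('o, 'm) monoidal_data = "('o, 'm) category_data" +
  tens :: "'o \<Rightarrow> 'o \<Rightarrow> 'o" (infixl "\<otimes>\<index>" 70)
  tensA :: "'m \<Rightarrow> 'm \<Rightarrow> 'm" (infixl "\<boxtimes>\<index>" 70)
  unitO :: "'o" ("\<I>\<index>")
  assoc :: "'o \<Rightarrow> 'o \<Rightarrow> 'o \<Rightarrow> 'm" ("\<alpha>\<index>")
  lunit :: "'o \<Rightarrow> 'm" ("\<ell>\<index>")
  swap :: "'o \<Rightarrow> 'o \<Rightarrow> 'm" ("\<sigma>\<index>")

locale symmetric_monoidal_category = category C for C (structure) +
  assumes tens_in_Obj: "\<lbrakk>a \<in> Obj C; b \<in> Obj C\<rbrakk> \<Longrightarrow> a \<otimes> b \<in> Obj C"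
    and unit_in_Obj: "\<I> \<in> Obj C"
    and tensA_in_hom: "\<lbrakk>f \<in> hom C a b; g \<in> hom C c d\<rbrakk> \<Longrightarrow> f \<boxtimes> g \<in> hom C (a \<otimes> c) (b \<otimes> d)"
    and tensA_Ident: "\<lbrakk>a \<in> Obj C; b \<in> Obj C\<rbrakk> \<Longrightarrow> \<one> a \<boxtimes> \<one> b = \<one> (a \<otimes> b)"
    and tensA_Comp: "\<lbrakk>f \<in> hom C a b; f' \<in> hom C b c; g \<in> hom C d e; g' \<in> hom C e k\<rbrakk>
      \<Longrightarrow> (f' \<cdot> f) \<boxtimes> (g' \<cdot> g) = (f' \<boxtimes> g') \<cdot> (f \<boxtimes> g)"
    and assoc_in_hom: "\<lbrakk>a \<in> Obj C; b \<in> Obj C; c \<in> Obj C\<rbrakk>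
      \<Longrightarrow> \<alpha> a b c \<in> hom C (a \<otimes> (b \<otimes> c)) ((a \<otimes> b) \<otimes> c)"
    and assoc_iso: "\<lbrakk>a \<in> Obj C; b \<in> Obj C; c \<in> Obj C\<rbrakk> \<Longrightarrow> is_iso C (\<alpha> a b c)"
    and assoc_natural: "\<lbrakk>f \<in> hom C a a'; g \<in> hom C b b'; h \<in> hom C c c'\<rbrakk>
      \<Longrightarrow> \<alpha> a' b' c' \<cdot> (f \<boxtimes> (g \<boxtimes> h)) = ((f \<boxtimes> g) \<boxtimes> h) \<cdot> \<alpha> a b c"
    and lunit_in_hom: "a \<in> Obj C \<Longrightarrow> \<ell> a \<in> hom C (\<I> \<otimes> a) a"
    and lunit_iso: "a \<in> Obj C \<Longrightarrow> is_iso C (\<ell> a)"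
    and lunit_natural: "f \<in> hom C a b \<Longrightarrow> \<ell> b \<cdot> (\<one> \<I> \<boxtimes> f) = f \<cdot> \<ell> a"
    and swap_in_hom: "\<lbrakk>a \<in> Obj C; b \<in> Obj C\<rbrakk> \<Longrightarrow> \<sigma> a b \<in> hom C (a \<otimes> b) (b \<otimes> a)"
    and swap_natural: "\<lbrakk>f \<in> hom C a a'; g \<in> hom C b b'\<rbrakk>
      \<Longrightarrow> \<sigma> a' b' \<cdot> (f \<boxtimes> g) = (g \<boxtimes> f) \<cdot> \<sigma> a b"
    and swap_swap: "\<lbrakk>a \<in> Obj C; b \<in> Obj C\<rbrakk> \<Longrightarrow> \<sigma> b a \<cdot> \<sigma> a b = \<one> (a \<otimes> b)"
    and pentagon: "\<lbrakk>a \<in> Obj C; b \<in> Obj C; c \<in> Obj C; d \<in> Obj C\<rbrakk>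
      \<Longrightarrow> \<alpha> (a \<otimes> b) c d \<cdot> \<alpha> a b (c \<otimes> d)
          = (\<alpha> a b c \<boxtimes> \<one> d) \<cdot> \<alpha> a (b \<otimes> c) d \<cdot> (\<one> a \<boxtimes> \<alpha> b c d)"
    and triangle: "\<lbrakk>a \<in> Obj C; b \<in> Obj C\<rbrakk>
      \<Longrightarrow> ((\<ell> a \<cdot> \<sigma> a \<I>) \<boxtimes> \<one> b) \<cdot> \<alpha> a \<I> b = \<one> a \<boxtimes> \<ell> b"
    and hexagon: "\<lbrakk>a \<in> Obj C; b \<in> Obj C; c \<in> Obj C\<rbrakk>
      \<Longrightarrow> \<alpha> c a b \<cdot> \<sigma> (a \<otimes> b) c \<cdot> \<alpha> a b c
          = (\<sigma> a c \<boxtimes> \<one> b) \<cdot> \<alpha> a c b \<cdot> (\<one> a \<boxtimes> \<sigma> b c)"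


section \<open>Compact closed and dagger compact closed categories\<close>

record ('o, 'm) compact_data = "('o, 'm) monoidal_data" +
  dual :: "'o \<Rightarrow> 'o" ("_\<star>\<index>" [1000] 1000)
  coev :: "'o \<Rightarrow> 'm" ("\<eta>\<index>")
  ev :: "'o \<Rightarrow> 'm" ("\<epsilon>\<index>")

locale compact_closed_category = symmetric_monoidal_category C for C (structure) +
  assumes dual_in_Obj: "a \<in> Obj C \<Longrightarrow> a\<star> \<in> Obj C"
    and coev_in_hom: "a \<in> Obj C \<Longrightarrow> \<eta> a \<in> hom C \<I> (a\<star> \<otimes> a)"
    and ev_in_hom: "a \<in> Obj C \<Longrightarrow> \<epsilon> a \<in> hom C (a \<otimes> a\<star>) \<I>"
    and snake_dual: "a \<in> Obj C
      \<Longrightarrow> (\<one> (a\<star>) \<boxtimes> \<epsilon> a) \<cdot> inv_arr C (\<alpha> (a\<star>) a (a\<star>)) \<cdot> (\<eta> a \<boxtimes> \<one> (a\<star>)) = \<sigma> \<I> (a\<star>)"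
    and snake: "a \<in> Obj C
      \<Longrightarrow> (\<epsilon> a \<boxtimes> \<one> a) \<cdot> \<alpha> a (a\<star>) a \<cdot> (\<one> a \<boxtimes> \<eta> a) = \<sigma> a \<I>"

record ('o, 'm) dagger_data = "('o, 'm) compact_data" +
  dagger :: "'m \<Rightarrow> 'm" ("_\<dagger>\<index>" [1000] 1000)

locale dagger_compact_closed_category = compact_closed_category C for C (structure) +
  assumes dagger_in_hom: "f \<in> hom C a b \<Longrightarrow> f\<dagger> \<in> hom C b a"
    and dagger_Ident: "a \<in> Obj C \<Longrightarrow> (\<one> a)\<dagger> = \<one> a"
    and dagger_Comp: "\<lbrakk>f \<in> hom C a b; g \<in> hom C b c\<rbrakk> \<Longrightarrow> (g \<cdot> f)\<dagger> = f\<dagger> \<cdot> g\<dagger>"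
    and dagger_dagger: "f \<in> Arr C \<Longrightarrow> f\<dagger>\<dagger> = f"
    and dagger_tensA: "\<lbrakk>f \<in> Arr C; g \<in> Arr C\<rbrakk> \<Longrightarrow> (f \<boxtimes> g)\<dagger> = f\<dagger> \<boxtimes> g\<dagger>"
    and dagger_assoc: "\<lbrakk>a \<in> Obj C; b \<in> Obj C; c \<in> Obj C\<rbrakk>
      \<Longrightarrow> (\<alpha> a b c)\<dagger> = inv_arr C (\<alpha> a b c)"
    and dagger_lunit: "a \<in> Obj C \<Longrightarrow> (\<ell> a)\<dagger> = inv_arr C (\<ell> a)"
    and dagger_swap: "\<lbrakk>a \<in> Obj C; b \<in> Obj C\<rbrakk> \<Longrightarrow> (\<sigma> a b)\<dagger> = \<sigma> b a"
    and dagger_ev: "a \<in> Obj C \<Longrightarrow> (\<epsilon> a)\<dagger> = \<sigma> (a\<star>) a \<cdot> \<eta> a"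

definition unitary :: "('o, 'm, 'x) dagger_data_scheme \<Rightarrow> 'm \<Rightarrow> bool" where
  "unitary C f \<longleftrightarrow> inverse_arrows C f (f\<dagger>\<^bsub>C\<^esub>)"

definition name :: "('o, 'm, 'x) compact_data_scheme \<Rightarrow> 'm \<Rightarrow> 'm" where
  "name C f = (\<one>\<^bsub>C\<^esub> ((Dom C f)\<star>\<^bsub>C\<^esub>) \<boxtimes>\<^bsub>C\<^esub> f) \<cdot>\<^bsub>C\<^esub> \<eta>\<^bsub>C\<^esub> (Dom C f)"

definition coname :: "('o, 'm, 'x) compact_data_scheme \<Rightarrow> 'm \<Rightarrow> 'm" where
  "coname C f = \<epsilon>\<^bsub>C\<^esub> (Cod C f) \<cdot>\<^bsub>C\<^esub> (f \<boxtimes>\<^bsub>C\<^esub> \<one>\<^bsub>C\<^esub> ((Cod C f)\<star>\<^bsub>C\<^esub>))"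

definition upper_star :: "('o, 'm, 'x) compact_data_scheme \<Rightarrow> 'm \<Rightarrow> 'm" where
  "upper_star C f = (let a = Dom C f; b = Cod C f in
     \<ell>\<^bsub>C\<^esub> (a\<star>\<^bsub>C\<^esub>) \<cdot>\<^bsub>C\<^esub> \<sigma>\<^bsub>C\<^esub> (a\<star>\<^bsub>C\<^esub>) \<I>\<^bsub>C\<^esub>
     \<cdot>\<^bsub>C\<^esub> (\<one>\<^bsub>C\<^esub> (a\<star>\<^bsub>C\<^esub>) \<boxtimes>\<^bsub>C\<^esub> \<epsilon>\<^bsub>C\<^esub> b)
     \<cdot>\<^bsub>C\<^esub> inv_arr C (\<alpha>\<^bsub>C\<^esub> (a\<star>\<^bsub>C\<^esub>) b (b\<star>\<^bsub>C\<^esub>))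
     \<cdot>\<^bsub>C\<^esub> ((\<one>\<^bsub>C\<^esub> (a\<star>\<^bsub>C\<^esub>) \<boxtimes>\<^bsub>C\<^esub> f) \<boxtimes>\<^bsub>C\<^esub> \<one>\<^bsub>C\<^esub> (b\<star>\<^bsub>C\<^esub>))
     \<cdot>\<^bsub>C\<^esub> (\<eta>\<^bsub>C\<^esub> a \<boxtimes>\<^bsub>C\<^esub> \<one>\<^bsub>C\<^esub> (b\<star>\<^bsub>C\<^esub>))
     \<cdot>\<^bsub>C\<^esub> inv_arr C (\<ell>\<^bsub>C\<^esub> (b\<star>\<^bsub>C\<^esub>)))"

definition lower_star :: "('o, 'm, 'x) dagger_data_scheme \<Rightarrow> 'm \<Rightarrow> 'm" where
  "lower_star C f = upper_star C (f\<dagger>\<^bsub>C\<^esub>)"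

definition Tr :: "('o, 'm, 'x) compact_data_scheme \<Rightarrow> 'm \<Rightarrow> 'm" where
  "Tr C f = (let a = Dom C f in
     \<epsilon>\<^bsub>C\<^esub> a \<cdot>\<^bsub>C\<^esub> (f \<boxtimes>\<^bsub>C\<^esub> \<one>\<^bsub>C\<^esub> (a\<star>\<^bsub>C\<^esub>)) \<cdot>\<^bsub>C\<^esub> \<sigma>\<^bsub>C\<^esub> (a\<star>\<^bsub>C\<^esub>) a \<cdot>\<^bsub>C\<^esub> \<eta>\<^bsub>C\<^esub> a)"


section \<open>Dagger biproducts\<close>

text \<open>Finite biproducts are given by a zero object and chosen binary biproducts.\<close>

record ('o, 'm) biproduct_data = "('o, 'm) dagger_data" +
  zeroO :: "'o" ("\<zero>\<index>")
  bip :: "'o \<Rightarrow> 'o \<Rightarrow> 'o" (infixl "\<oplus>\<index>" 65)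
  prj1 :: "'o \<Rightarrow> 'o \<Rightarrow> 'm"
  prj2 :: "'o \<Rightarrow> 'o \<Rightarrow> 'm"
  inj1 :: "'o \<Rightarrow> 'o \<Rightarrow> 'm"
  inj2 :: "'o \<Rightarrow> 'o \<Rightarrow> 'm"

definition zero_arr :: "('o, 'm, 'x) biproduct_data_scheme \<Rightarrow> 'o \<Rightarrow> 'o \<Rightarrow> 'm" where
  "zero_arr C a b = (THE g. g \<in> hom C \<zero>\<^bsub>C\<^esub> b) \<cdot>\<^bsub>C\<^esub> (THE f. f \<in> hom C a \<zero>\<^bsub>C\<^esub>)"

locale biproduct_category = category C for C (structure) +
  assumes zero_in_Obj: "\<zero> \<in> Obj C"
    and zero_initial: "a \<in> Obj C \<Longrightarrow> \<exists>!f. f \<in> hom C \<zero> a"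
    and zero_terminal: "a \<in> Obj C \<Longrightarrow> \<exists>!f. f \<in> hom C a \<zero>"
    and bip_in_Obj: "\<lbrakk>a \<in> Obj C; b \<in> Obj C\<rbrakk> \<Longrightarrow> a \<oplus> b \<in> Obj C"
    and prj1_in_hom: "\<lbrakk>a \<in> Obj C; b \<in> Obj C\<rbrakk> \<Longrightarrow> prj1 C a b \<in> hom C (a \<oplus> b) a"
    and prj2_in_hom: "\<lbrakk>a \<in> Obj C; b \<in> Obj C\<rbrakk> \<Longrightarrow> prj2 C a b \<in> hom C (a \<oplus> b) b"
    and inj1_in_hom: "\<lbrakk>a \<in> Obj C; b \<in> Obj C\<rbrakk> \<Longrightarrow> inj1 C a b \<in> hom C a (a \<oplus> b)"
    and inj2_in_hom: "\<lbrakk>a \<in> Obj C; b \<in> Obj C\<rbrakk> \<Longrightarrow> inj2 C a b \<in> hom C b (a \<oplus> b)"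
    and bip_product: "\<lbrakk>a \<in> Obj C; b \<in> Obj C; f \<in> hom C c a; g \<in> hom C c b\<rbrakk>
      \<Longrightarrow> \<exists>!h. h \<in> hom C c (a \<oplus> b) \<and> prj1 C a b \<cdot> h = f \<and> prj2 C a b \<cdot> h = g"
    and bip_coproduct: "\<lbrakk>a \<in> Obj C; b \<in> Obj C; f \<in> hom C a c; g \<in> hom C b c\<rbrakk>
      \<Longrightarrow> \<exists>!h. h \<in> hom C (a \<oplus> b) c \<and> h \<cdot> inj1 C a b = f \<and> h \<cdot> inj2 C a b = g"
    and prj1_inj1: "\<lbrakk>a \<in> Obj C; b \<in> Obj C\<rbrakk> \<Longrightarrow> prj1 C a b \<cdot> inj1 C a b = \<one> a"
    and prj2_inj2: "\<lbrakk>a \<in> Obj C; b \<in> Obj C\<rbrakk> \<Longrightarrow> prj2 C a b \<cdot> inj2 C a b = \<one> b"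
    and prj1_inj2: "\<lbrakk>a \<in> Obj C; b \<in> Obj C\<rbrakk> \<Longrightarrow> prj1 C a b \<cdot> inj2 C a b = zero_arr C b a"
    and prj2_inj1: "\<lbrakk>a \<in> Obj C; b \<in> Obj C\<rbrakk> \<Longrightarrow> prj2 C a b \<cdot> inj1 C a b = zero_arr C a b"

locale dagger_compact_closed_category_with_dagger_biproducts =
  dagger_compact_closed_category C + biproduct_category C for C (structure) +
  assumes dagger_prj1: "\<lbrakk>a \<in> Obj C; b \<in> Obj C\<rbrakk> \<Longrightarrow> (prj1 C a b)\<dagger> = inj1 C a b"
    and dagger_prj2: "\<lbrakk>a \<in> Obj C; b \<in> Obj C\<rbrakk> \<Longrightarrow> (prj2 C a b)\<dagger> = inj2 C a b"

definition bipA :: "('o, 'm, 'x) biproduct_data_scheme \<Rightarrow> 'm \<Rightarrow> 'm \<Rightarrow> 'm" where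
  "bipA C f g = (THE h.
     h \<in> hom C (Dom C f \<oplus>\<^bsub>C\<^esub> Dom C g) (Cod C f \<oplus>\<^bsub>C\<^esub> Cod C g) \<and>
     prj1 C (Cod C f) (Cod C g) \<cdot>\<^bsub>C\<^esub> h = f \<cdot>\<^bsub>C\<^esub> prj1 C (Dom C f) (Dom C g) \<and>
     prj2 C (Cod C f) (Cod C g) \<cdot>\<^bsub>C\<^esub> h = g \<cdot>\<^bsub>C\<^esub> prj2 C (Dom C f) (Dom C g))"

text \<open>
  \<open>n\<close>-fold biproducts, associated to the left; the \<open>1\<close>-fold biproduct of \<open>a\<close> is \<open>a\<close> itself,
  and components are numbered \<open>1, \<dots>, n\<close>.
\<close>

fun nfold :: "('o, 'm, 'x) biproduct_data_scheme \<Rightarrow> nat \<Rightarrow> 'o \<Rightarrow> 'o" where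
  "nfold C 0 a = \<zero>\<^bsub>C\<^esub>"
| "nfold C (Suc 0) a = a"
| "nfold C (Suc (Suc n)) a = nfold C (Suc n) a \<oplus>\<^bsub>C\<^esub> a"

fun nfoldA :: "('o, 'm, 'x) biproduct_data_scheme \<Rightarrow> nat \<Rightarrow> 'm \<Rightarrow> 'm" where
  "nfoldA C 0 f = \<one>\<^bsub>C\<^esub> \<zero>\<^bsub>C\<^esub>"
| "nfoldA C (Suc 0) f = f"
| "nfoldA C (Suc (Suc n)) f = bipA C (nfoldA C (Suc n) f) f"

fun nprj :: "('o, 'm, 'x) biproduct_data_scheme \<Rightarrow> nat \<Rightarrow> 'o \<Rightarrow> nat \<Rightarrow> 'm" where
  "nprj C 0 a i = undefined"
| "nprj C (Suc 0) a i = \<one>\<^bsub>C\<^esub> a"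
| "nprj C (Suc (Suc n)) a i =
     (if i = Suc (Suc n) then prj2 C (nfold C (Suc n) a) a
      else nprj C (Suc n) a i \<cdot>\<^bsub>C\<^esub> prj1 C (nfold C (Suc n) a) a)"

definition tuple :: "('o, 'm, 'x) biproduct_data_scheme \<Rightarrow> nat \<Rightarrow> 'o \<Rightarrow> 'o \<Rightarrow> (nat \<Rightarrow> 'm) \<Rightarrow> 'm" where
  "tuple C n c a f =
     (THE h. h \<in> hom C c (nfold C n a) \<and> (\<forall>i\<in>{1..n}. nprj C n a i \<cdot>\<^bsub>C\<^esub> h = f i))"

text \<open>
  The arrow from \<open>c\<close> to the \<open>(m * n)\<close>-fold biproduct of \<open>a\<close> whose component with index \<open>n * (i - 1) + j\<close> is \<open>f i j\<close>,
  for \<open>1 \<le> i \<le> m\<close> and \<open>1 \<le> j \<le> n\<close>.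
\<close>

definition tuple2 ::
  "('o, 'm, 'x) biproduct_data_scheme \<Rightarrow> nat \<Rightarrow> nat \<Rightarrow> 'o \<Rightarrow> 'o \<Rightarrow> (nat \<Rightarrow> nat \<Rightarrow> 'm) \<Rightarrow> 'm" where
  "tuple2 C m n c a f =
     (THE h. h \<in> hom C c (nfold C (m * n) a) \<and>
        (\<forall>i\<in>{1..m}. \<forall>j\<in>{1..n}. nprj C (m * n) a (n * (i - 1) + j) \<cdot>\<^bsub>C\<^esub> h = f i j))"

text \<open>The canonical isomorphism from the \<open>m\<close>-fold biproduct of \<open>n\<close>-fold biproducts.\<close>

definition flatten :: "('o, 'm, 'x) biproduct_data_scheme \<Rightarrow> nat \<Rightarrow> nat \<Rightarrow> 'o \<Rightarrow> 'm" where
  "flatten C m n a = tuple2 C m n (nfold C m (nfold C n a)) a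
     (\<lambda>i j. nprj C n a j \<cdot>\<^bsub>C\<^esub> nprj C m (nfold C n a) i)"

text \<open>The distributivity isomorphism \<open>nfold C n a \<otimes> b \<rightarrow> nfold C n (a \<otimes> b)\<close>.\<close>

definition distrib :: "('o, 'm, 'x) biproduct_data_scheme \<Rightarrow> nat \<Rightarrow> 'o \<Rightarrow> 'o \<Rightarrow> 'm" ("\<upsilon>\<index>") where
  "\<upsilon>\<^bsub>C\<^esub> n a b = tuple C n (nfold C n a \<otimes>\<^bsub>C\<^esub> b) (a \<otimes>\<^bsub>C\<^esub> b)
     (\<lambda>i. nprj C n a i \<boxtimes>\<^bsub>C\<^esub> \<one>\<^bsub>C\<^esub> b)"


subsection \<open>The tuples are well defined\<close>

context biproduct_category
begin

lemma nfold_in_Obj: "a \<in> Obj C \<Longrightarrow> nfold C n a \<in> Obj C"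
proof (induction n)
  case (Suc n)
  then show ?case by (cases n) (auto intro: bip_in_Obj)
qed (simp add: zero_in_Obj)

lemma nprj_in_hom:
  assumes "a \<in> Obj C" "i \<in> {1..n}"
  shows "nprj C n a i \<in> hom C (nfold C n a) a"
  using assms(2)
proof (induction n)
  case (Suc n)
  show ?case
  proof (cases n)
    case 0
    then show ?thesis using assms(1) by (simp add: Ident_in_hom)
  next
    case (Suc m)
    have o: "nfold C (Suc m) a \<in> Obj C" using assms(1) by (rule nfold_in_Obj)
    show ?thesis
      using Suc.IH Suc.prems Suc assms(1) o
      by (auto intro!: prj2_in_hom Comp_in_hom[OF prj1_in_hom])
  qed
qed simp

lemma tuple_ex1:
  assumes "a \<in> Obj C" "c \<in> Obj C" "\<And>i. i \<in> {1..n} \<Longrightarrow> f i \<in> hom C c a"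
  shows "\<exists>!h. h \<in> hom C c (nfold C n a) \<and> (\<forall>i\<in>{1..n}. nprj C n a i \<cdot> h = f i)"
  using assms(3)
proof (induction n)
  case 0
  then show ?case using zero_terminal[OF assms(2)] by simp
next
  case (Suc n)
  show ?case
  proof (cases n)
    case 0
    have "f 1 \<in> hom C c a" using Suc.prems[of 1] by simp
    then show ?thesis using 0 by (auto intro!: ex1I[of _ "f 1"] simp: Ident_left)
  next
    case n: (Suc m)
    let ?b = "nfold C n a" and ?p = "prj1 C (nfold C n a) a" and ?q = "prj2 C (nfold C n a) a"
    have b: "?b \<in> Obj C" using assms(1) by (rule nfold_in_Obj)
    have p: "?p \<in> hom C (?b \<oplus> a) ?b" using prj1_in_hom[OF b assms(1)] .
    have fold: "nfold C (Suc n) a = ?b \<oplus> a" using n by simp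
    have split: "{1..Suc n} = insert (Suc n) {1..n}" by auto
    have last: "nprj C (Suc n) a (Suc n) = ?q" using n by simp
    have init: "nprj C (Suc n) a i \<cdot> h = nprj C n a i \<cdot> (?p \<cdot> h)"
      if "i \<in> {1..n}" "h \<in> hom C c (?b \<oplus> a)" for i h
      using that n Comp_assoc[OF that(2) p nprj_in_hom[OF assms(1) that(1)]] by auto
    have ex: "\<exists>!g. g \<in> hom C c ?b \<and> (\<forall>i\<in>{1..n}. nprj C n a i \<cdot> g = f i)"
      using Suc.IH Suc.prems by auto
    then obtain g where g: "g \<in> hom C c ?b" "\<forall>i\<in>{1..n}. nprj C n a i \<cdot> g = f i" by blast
    have eq: "(h \<in> hom C c (nfold C (Suc n) a) \<and> (\<forall>i\<in>{1..Suc n}. nprj C (Suc n) a i \<cdot> h = f i))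
      \<longleftrightarrow> (h \<in> hom C c (?b \<oplus> a) \<and> ?p \<cdot> h = g \<and> ?q \<cdot> h = f (Suc n))" for h
    proof (cases "h \<in> hom C c (?b \<oplus> a)")
      case True
      have "?p \<cdot> h \<in> hom C c ?b" using Comp_in_hom[OF True p] .
      then have "(\<forall>i\<in>{1..n}. nprj C n a i \<cdot> (?p \<cdot> h) = f i) \<longleftrightarrow> ?p \<cdot> h = g"
        using ex g by auto
      then show ?thesis unfolding fold split using True init last by auto
    qed (simp add: fold)
    show ?thesis unfolding eq
      using bip_product[OF b assms(1) g(1)] Suc.prems[of "Suc n"] by simp
  qed
qed

lemma tuple2_ex1:
  assumes "a \<in> Obj C" "c \<in> Obj C"
    and "\<And>i j. \<lbrakk>i \<in> {1..m}; j \<in> {1..n}\<rbrakk> \<Longrightarrow> f i j \<in> hom C c a"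
  shows "\<exists>!h. h \<in> hom C c (nfold C (m * n) a) \<and>
    (\<forall>i\<in>{1..m}. \<forall>j\<in>{1..n}. nprj C (m * n) a (n * (i - 1) + j) \<cdot> h = f i j)"
proof -
  let ?I = "\<lambda>k. (k - 1) div n + 1" and ?J = "\<lambda>k. (k - 1) mod n + 1"
  have IJ: "?I k \<in> {1..m} \<and> ?J k \<in> {1..n} \<and> n * (?I k - 1) + ?J k = k" if "k \<in> {1..m * n}" for k
  proof -
    have "0 < n" using that by (cases n) auto
    moreover have "(k - 1) div n < m"
      using that by (intro less_mult_imp_div_less) auto
    moreover have "n * ((k - 1) div n) + (k - 1) mod n = k - 1" by simp
    ultimately show ?thesis using that
      by (auto simp: Suc_le_eq simp del: mult_div_mod_eq)
  qed
  have K: "n * (i - 1) + j \<in> {1..m * n} \<and> ?I (n * (i - 1) + j) = i \<and> ?J (n * (i - 1) + j) = j"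
    if ij: "i \<in> {1..m}" "j \<in> {1..n}" for i j
  proof -
    obtain i' where i': "i = Suc i'" using ij(1) by (cases i) auto
    obtain j' where j': "j = Suc j'" using ij(2) by (cases j) auto
    have "n * i' + n = n * Suc i'" by simp
    also have "\<dots> \<le> n * m" using ij i' by (intro mult_le_mono2) auto
    finally have "n * i' + j \<le> m * n" using ij by (simp add: mult.commute)
    then show ?thesis using ij i' j' by auto
  qed
  have "(\<forall>i\<in>{1..m}. \<forall>j\<in>{1..n}. nprj C (m * n) a (n * (i - 1) + j) \<cdot> h = f i j)
    \<longleftrightarrow> (\<forall>k\<in>{1..m * n}. nprj C (m * n) a k \<cdot> h = f (?I k) (?J k))" (is "?L \<longleftrightarrow> ?R") for h
  proof
    assume ?L
    then show ?R using IJ by (metis (no_types, lifting))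
  next
    assume ?R
    then show ?L using K by (metis (no_types, lifting))
  qed
  moreover have "\<exists>!h. h \<in> hom C c (nfold C (m * n) a) \<and>
      (\<forall>k\<in>{1..m * n}. nprj C (m * n) a k \<cdot> h = f (?I k) (?J k))"
    using assms(1,2) IJ by (intro tuple_ex1 assms(3)) auto
  ultimately show ?thesis by simp
qed

lemma bipA_ex1:
  assumes "f \<in> Arr C" "g \<in> Arr C"
  shows "\<exists>!h. h \<in> hom C (Dom C f \<oplus> Dom C g) (Cod C f \<oplus> Cod C g) \<and>
     prj1 C (Cod C f) (Cod C g) \<cdot> h = f \<cdot> prj1 C (Dom C f) (Dom C g) \<and>
     prj2 C (Cod C f) (Cod C g) \<cdot> h = g \<cdot> prj2 C (Dom C f) (Dom C g)"
proof -
  have o: "Dom C f \<in> Obj C" "Dom C g \<in> Obj C" "Cod C f \<in> Obj C" "Cod C g \<in> Obj C"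
    using assms by (simp_all add: Dom_in_Obj Cod_in_Obj)
  have "f \<in> hom C (Dom C f) (Cod C f)" "g \<in> hom C (Dom C g) (Cod C g)"
    using assms by (simp_all add: hom_def)
  then show ?thesis
    using bip_product[OF o(3,4) Comp_in_hom[OF prj1_in_hom[OF o(1,2)]]
        Comp_in_hom[OF prj2_in_hom[OF o(1,2)]]] by blast
qed

end

end

theory Submission
  imports Defs
begin

text \<open>
  An arrow into an iterated biproduct is determined by its components, and every stage of the
  protocol acts componentwise: the sender's stage by the choice \<open>i\<close> of an encoding
  \<open>lower_star C (\<beta> i)\<close>, the receiver's stage by the outcome \<open>j\<close> of a measurement
  \<open>coname C (\<beta> j)\<close>.  Hence (\<open>superdense_components\<close>) the component of the composite at \<open>(i, j)\<close> is
  \<open>coname C (\<beta> j) \<cdot> \<sigma> (Q\<star>) Q \<cdot> (lower_star C (\<beta> i) \<boxtimes> \<one> Q) \<cdot> \<eta> Q\<close>.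
  Since \<open>lower_star C (\<beta> i)\<close> is the transpose of \<open>(\<beta> i)\<^sup>\<dagger>\<close>, it slides around \<open>\<eta> Q\<close> and becomes \<open>(\<beta> i)\<^sup>\<dagger>\<close> on
  the other half of the pair (\<open>upper_star_coev\<close>), which closes the loop into the trace of
  \<open>\<beta> j \<cdot> (\<beta> i)\<^sup>\<dagger>\<close> (\<open>coname_upper_star_coev\<close>).  The theorem names the trace of \<open>\<beta> i \<cdot> (\<beta> j)\<^sup>\<dagger>\<close> instead;
  the two agree trivially for \<open>i = j\<close>, and by the orthogonality hypothesis both are zero otherwise.

  The sliding step is where the work lies, because the monoidal structure is not strict.  It is one
  snake identity, but bringing the snake into position moves brackets and units, and for this the
  coherence facts \<open>lunit_tens\<close>, \<open>runit_tens\<close> and \<open>runit_unit\<close> have to be derived from the pentagon and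
  the triangle.  With the right unitor taken to be \<open>\<ell> a \<cdot> \<sigma> a \<I>\<close> these are Kelly's arguments for plain
  monoidal categories.
\<close>

section \<open>Composition with computed domains and codomains\<close>

context category
begin

text \<open>
  The axioms speak of homsets, whose intermediate objects a rewriter cannot guess.  Stated with
  \<open>Dom\<close> and \<open>Cod\<close> their side conditions can be computed from the arrows.
\<close>

lemma hom_iff: "f \<in> hom C a b \<longleftrightarrow> f \<in> Arr C \<and> Dom C f = a \<and> Cod C f = b"
  by (auto simp: hom_def)

lemma arr_Comp [simp]:
  assumes "f \<in> Arr C" "g \<in> Arr C" "Dom C g = Cod C f"
  shows "g \<cdot> f \<in> Arr C" "Dom C (g \<cdot> f) = Dom C f" "Cod C (g \<cdot> f) = Cod C g"
  using Comp_in_hom[of f "Dom C f" "Cod C f" g "Cod C g"] assms by (auto simp: hom_iff)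

lemma arr_Ident [simp]:
  assumes "a \<in> Obj C"
  shows "\<one> a \<in> Arr C" "Dom C (\<one> a) = a" "Cod C (\<one> a) = a"
  using Ident_in_hom[OF assms] by (auto simp: hom_iff)

lemma Comp_assoc_arr [simp]:
  "\<lbrakk>f \<in> Arr C; g \<in> Arr C; h \<in> Arr C; Dom C g = Cod C f; Dom C h = Cod C g\<rbrakk>
    \<Longrightarrow> (h \<cdot> g) \<cdot> f = h \<cdot> (g \<cdot> f)"
  using Comp_assoc[of f "Dom C f" "Cod C f" g "Cod C g" h "Cod C h"] by (auto simp: hom_iff)

lemma Ident_left_arr [simp]: "\<lbrakk>f \<in> Arr C; Cod C f = b\<rbrakk> \<Longrightarrow> \<one> b \<cdot> f = f"
  using Ident_left[of f "Dom C f" b] by (auto simp: hom_iff)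

lemma Ident_right_arr [simp]: "\<lbrakk>f \<in> Arr C; Dom C f = a\<rbrakk> \<Longrightarrow> f \<cdot> \<one> a = f"
  using Ident_right[of f a "Cod C f"] by (auto simp: hom_iff)

text \<open>Lets an equation between composites be used inside a longer, right-nested composite.\<close>

lemma reassoc:
  assumes "f \<cdot> g = h"
    and "f \<in> Arr C" "g \<in> Arr C" "k \<in> Arr C" "Dom C f = Cod C g" "Dom C g = Cod C k"
  shows "f \<cdot> (g \<cdot> k) = h \<cdot> k"
  using assms by (metis Comp_assoc_arr)

lemma inverse_arrows_unique:
  assumes "inverse_arrows C f g" "inverse_arrows C f g'"
  shows "g = g'"
proof -
  have "g = g \<cdot> (f \<cdot> g')" using assms by (auto simp: inverse_arrows_def hom_iff)
  also have "\<dots> = (g \<cdot> f) \<cdot> g'"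
    using assms by (subst Comp_assoc_arr) (auto simp: inverse_arrows_def hom_iff)
  also have "\<dots> = g'" using assms by (auto simp: inverse_arrows_def hom_iff simp del: Comp_assoc_arr)
  finally show ?thesis .
qed

lemma inv_arr:
  assumes "is_iso C f"
  shows "inv_arr C f \<in> hom C (Cod C f) (Dom C f)"
    and "inv_arr C f \<cdot> f = \<one> (Dom C f)" and "f \<cdot> inv_arr C f = \<one> (Cod C f)"
proof -
  obtain g where "inverse_arrows C f g" using assms by (auto simp: is_iso_def)
  then have "inverse_arrows C f (inv_arr C f)"
    unfolding inv_arr_def using inverse_arrows_unique by (metis theI)
  then show "inv_arr C f \<in> hom C (Cod C f) (Dom C f)"
    and "inv_arr C f \<cdot> f = \<one> (Dom C f)" and "f \<cdot> inv_arr C f = \<one> (Cod C f)"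
    by (auto simp: inverse_arrows_def)
qed

lemma is_iso_Comp:
  assumes "is_iso C f" "is_iso C g" "Dom C g = Cod C f"
  shows "is_iso C (g \<cdot> f)"
proof -
  obtain f' g' where f': "inverse_arrows C f f'" and g': "inverse_arrows C g g'"
    using assms(1,2) by (auto simp: is_iso_def)
  have "f' \<cdot> g' \<cdot> g \<cdot> f = f' \<cdot> f"
    using f' g' assms(3) reassoc[of g' g "\<one> (Dom C g)" f]
    by (auto simp: inverse_arrows_def hom_iff)
  moreover have "g \<cdot> f \<cdot> f' \<cdot> g' = g \<cdot> g'"
    using f' g' assms(3) reassoc[of f f' "\<one> (Cod C f)" g']
    by (auto simp: inverse_arrows_def hom_iff)
  ultimately have "inverse_arrows C (g \<cdot> f) (f' \<cdot> g')"
    using f' g' assms(3) by (auto simp: inverse_arrows_def hom_iff)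
  then show ?thesis by (auto simp: is_iso_def)
qed

lemma iso_cancel_left:
  assumes "f \<cdot> g = f \<cdot> h" "is_iso C f" "f \<in> Arr C" "g \<in> Arr C" "h \<in> Arr C"
    "Cod C g = Dom C f" "Cod C h = Dom C f"
  shows "g = h"
proof -
  have "inv_arr C f \<cdot> (f \<cdot> k) = k" if "k \<in> Arr C" "Cod C k = Dom C f" for k
    using reassoc[OF inv_arr(2)[OF assms(2)] _ assms(3) that(1)] inv_arr(1)[OF assms(2)] that
    by (simp add: hom_iff)
  then show ?thesis using assms by metis
qed

lemma iso_cancel_right:
  assumes "g \<cdot> f = h \<cdot> f" "is_iso C f" "f \<in> Arr C" "g \<in> Arr C" "h \<in> Arr C"
    "Dom C g = Cod C f" "Dom C h = Cod C f"
  shows "g = h"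
proof -
  have "(k \<cdot> f) \<cdot> inv_arr C f = k" if "k \<in> Arr C" "Dom C k = Cod C f" for k
    using inv_arr[OF assms(2)] that assms(3) by (simp add: hom_iff)
  then show ?thesis using assms by metis
qed

end


section \<open>Coherence of the unit\<close>

context symmetric_monoidal_category
begin

definition runit :: "'a \<Rightarrow> 'b" where
  "runit a = \<ell> a \<cdot> \<sigma> a \<I>"

lemma tens_Obj [simp]: "\<lbrakk>a \<in> Obj C; b \<in> Obj C\<rbrakk> \<Longrightarrow> a \<otimes> b \<in> Obj C"
  by (rule tens_in_Obj)

lemma unit_Obj [simp]: "\<I> \<in> Obj C"
  by (rule unit_in_Obj)

lemma Dom_Cod_Obj [simp]: "f \<in> Arr C \<Longrightarrow> Dom C f \<in> Obj C" "f \<in> Arr C \<Longrightarrow> Cod C f \<in> Obj C"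
  by (rule Dom_in_Obj Cod_in_Obj; assumption)+

lemma arr_tensA [simp]:
  assumes "f \<in> Arr C" "g \<in> Arr C"
  shows "f \<boxtimes> g \<in> Arr C" "Dom C (f \<boxtimes> g) = Dom C f \<otimes> Dom C g"
    "Cod C (f \<boxtimes> g) = Cod C f \<otimes> Cod C g"
  using tensA_in_hom[of f "Dom C f" "Cod C f" g "Dom C g" "Cod C g"] assms
  by (auto simp: hom_iff)

lemma arr_assoc [simp]:
  assumes "a \<in> Obj C" "b \<in> Obj C" "c \<in> Obj C"
  shows "\<alpha> a b c \<in> Arr C" "Dom C (\<alpha> a b c) = a \<otimes> (b \<otimes> c)" "Cod C (\<alpha> a b c) = a \<otimes> b \<otimes> c"
  using assoc_in_hom[OF assms] by (auto simp: hom_iff)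

lemma inv_assoc [simp]:
  assumes "a \<in> Obj C" "b \<in> Obj C" "c \<in> Obj C"
  shows "inv_arr C (\<alpha> a b c) \<in> Arr C" "Dom C (inv_arr C (\<alpha> a b c)) = a \<otimes> b \<otimes> c"
    "Cod C (inv_arr C (\<alpha> a b c)) = a \<otimes> (b \<otimes> c)"
    "inv_arr C (\<alpha> a b c) \<cdot> \<alpha> a b c = \<one> (a \<otimes> (b \<otimes> c))"
    "\<alpha> a b c \<cdot> inv_arr C (\<alpha> a b c) = \<one> (a \<otimes> b \<otimes> c)"
  using inv_arr[OF assoc_iso[OF assms]] assms by (auto simp: hom_iff)

lemma arr_lunit [simp]:
  assumes "a \<in> Obj C"
  shows "\<ell> a \<in> Arr C" "Dom C (\<ell> a) = \<I> \<otimes> a" "Cod C (\<ell> a) = a"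
  using lunit_in_hom[OF assms] by (auto simp: hom_iff)

lemma inv_lunit [simp]:
  assumes "a \<in> Obj C"
  shows "inv_arr C (\<ell> a) \<in> Arr C" "Dom C (inv_arr C (\<ell> a)) = a"
    "Cod C (inv_arr C (\<ell> a)) = \<I> \<otimes> a"
    "inv_arr C (\<ell> a) \<cdot> \<ell> a = \<one> (\<I> \<otimes> a)" "\<ell> a \<cdot> inv_arr C (\<ell> a) = \<one> a"
  using inv_arr[OF lunit_iso[OF assms]] assms by (auto simp: hom_iff)

lemma arr_swap [simp]:
  assumes "a \<in> Obj C" "b \<in> Obj C"
  shows "\<sigma> a b \<in> Arr C" "Dom C (\<sigma> a b) = a \<otimes> b" "Cod C (\<sigma> a b) = b \<otimes> a"
  using swap_in_hom[OF assms] by (auto simp: hom_iff)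

lemma arr_runit [simp]:
  assumes "a \<in> Obj C"
  shows "runit a \<in> Arr C" "Dom C (runit a) = a \<otimes> \<I>" "Cod C (runit a) = a"
  using assms by (auto simp: runit_def)

lemma tensA_Ident_Ident [simp]:
  "\<lbrakk>a \<in> Obj C; b \<in> Obj C\<rbrakk> \<Longrightarrow> \<one> a \<boxtimes> \<one> b = \<one> (a \<otimes> b)"
  by (rule tensA_Ident)

lemma interchange:
  "\<lbrakk>f \<in> Arr C; f' \<in> Arr C; g \<in> Arr C; g' \<in> Arr C; Dom C f' = Cod C f; Dom C g' = Cod C g\<rbrakk>
    \<Longrightarrow> (f' \<boxtimes> g') \<cdot> (f \<boxtimes> g) = (f' \<cdot> f) \<boxtimes> (g' \<cdot> g)"
  using tensA_Comp[of f "Dom C f" "Cod C f" f' "Cod C f'" g "Dom C g" "Cod C g" g' "Cod C g'"]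
  by (auto simp: hom_iff)

lemma interchange_reassoc:
  "\<lbrakk>f \<in> Arr C; f' \<in> Arr C; g \<in> Arr C; g' \<in> Arr C; Dom C f' = Cod C f; Dom C g' = Cod C g;
    k \<in> Arr C; Cod C k = Dom C f \<otimes> Dom C g\<rbrakk>
    \<Longrightarrow> (f' \<boxtimes> g') \<cdot> (f \<boxtimes> g) \<cdot> k = ((f' \<cdot> f) \<boxtimes> (g' \<cdot> g)) \<cdot> k"
  by (rule reassoc[OF interchange]) auto

lemma assoc_natural_arr:
  "\<lbrakk>f \<in> Arr C; g \<in> Arr C; h \<in> Arr C\<rbrakk>
    \<Longrightarrow> \<alpha> (Cod C f) (Cod C g) (Cod C h) \<cdot> (f \<boxtimes> (g \<boxtimes> h))
      = ((f \<boxtimes> g) \<boxtimes> h) \<cdot> \<alpha> (Dom C f) (Dom C g) (Dom C h)"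
  by (rule assoc_natural) (auto simp: hom_iff)

lemma inv_assoc_natural:
  assumes [simp]: "f \<in> Arr C" "g \<in> Arr C" "h \<in> Arr C"
  shows "inv_arr C (\<alpha> (Cod C f) (Cod C g) (Cod C h)) \<cdot> ((f \<boxtimes> g) \<boxtimes> h)
      = (f \<boxtimes> (g \<boxtimes> h)) \<cdot> inv_arr C (\<alpha> (Dom C f) (Dom C g) (Dom C h))"
    (is "?i \<cdot> ?r = ?l \<cdot> ?j")
proof -
  have "?i \<cdot> ?r = ?i \<cdot> (?r \<cdot> \<alpha> (Dom C f) (Dom C g) (Dom C h)) \<cdot> ?j"
    by simp
  also have "\<dots> = ?i \<cdot> \<alpha> (Cod C f) (Cod C g) (Cod C h) \<cdot> ?l \<cdot> ?j"
    by (simp flip: assoc_natural_arr)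
  also have "\<dots> = ?l \<cdot> ?j"
    by (subst reassoc[OF inv_assoc(4)]) simp_all
  finally show ?thesis .
qed

lemma inv_lunit_natural:
  assumes [simp]: "f \<in> Arr C"
  shows "inv_arr C (\<ell> (Cod C f)) \<cdot> f = (\<one> \<I> \<boxtimes> f) \<cdot> inv_arr C (\<ell> (Dom C f))"
proof -
  have n: "\<ell> (Cod C f) \<cdot> (\<one> \<I> \<boxtimes> f) = f \<cdot> \<ell> (Dom C f)"
    by (rule lunit_natural) (simp add: hom_iff)
  have "\<ell> (Cod C f) \<cdot> (\<one> \<I> \<boxtimes> f) \<cdot> inv_arr C (\<ell> (Dom C f)) = f"
    by (subst reassoc[OF n]) simp_all
  then have "inv_arr C (\<ell> (Cod C f)) \<cdot> f
      = inv_arr C (\<ell> (Cod C f)) \<cdot> \<ell> (Cod C f) \<cdot> (\<one> \<I> \<boxtimes> f) \<cdot> inv_arr C (\<ell> (Dom C f))"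
    by simp
  also have "\<dots> = (\<one> \<I> \<boxtimes> f) \<cdot> inv_arr C (\<ell> (Dom C f))"
    by (subst reassoc[OF inv_lunit(4)]) simp_all
  finally show ?thesis .
qed

lemma runit_natural:
  assumes [simp]: "f \<in> Arr C"
  shows "runit (Cod C f) \<cdot> (f \<boxtimes> \<one> \<I>) = f \<cdot> runit (Dom C f)"
proof -
  have s: "\<sigma> (Cod C f) \<I> \<cdot> (f \<boxtimes> \<one> \<I>) = (\<one> \<I> \<boxtimes> f) \<cdot> \<sigma> (Dom C f) \<I>"
    by (rule swap_natural) (simp_all add: hom_iff)
  have n: "\<ell> (Cod C f) \<cdot> (\<one> \<I> \<boxtimes> f) = f \<cdot> \<ell> (Dom C f)"
    by (rule lunit_natural) (simp add: hom_iff)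
  show ?thesis
    using reassoc[OF n, of "\<sigma> (Dom C f) \<I>"] by (simp add: runit_def s)
qed

lemma runit_iso: "a \<in> Obj C \<Longrightarrow> is_iso C (runit a)"
proof -
  assume [simp]: "a \<in> Obj C"
  have "is_iso C (\<sigma> a \<I>)"
    unfolding is_iso_def
    by (rule exI[of _ "\<sigma> \<I> a"]) (simp add: inverse_arrows_def hom_iff swap_swap)
  then show ?thesis
    unfolding runit_def by (intro is_iso_Comp lunit_iso) simp_all
qed

text \<open>
  Tensoring with the unit is faithful on either side, since \<open>\<ell>\<close> and \<open>runit\<close> are natural isomorphisms
  to the identity functor.
\<close>

lemma lunit_faithful:
  assumes "\<one> \<I> \<boxtimes> f = \<one> \<I> \<boxtimes> g" and "f \<in> hom C a b" "g \<in> hom C a b"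
  shows "f = g"
proof -
  have [simp]: "a \<in> Obj C" "b \<in> Obj C" using assms by (auto simp: hom_iff)
  have "f \<cdot> \<ell> a = g \<cdot> \<ell> a"
    using lunit_natural[OF assms(2)] lunit_natural[OF assms(3)] assms(1) by simp
  then show ?thesis
    by (rule iso_cancel_right) (use assms lunit_iso in \<open>auto simp: hom_iff\<close>)
qed

lemma runit_faithful:
  assumes "f \<boxtimes> \<one> \<I> = g \<boxtimes> \<one> \<I>" and "f \<in> hom C a b" "g \<in> hom C a b"
  shows "f = g"
proof -
  have [simp]: "a \<in> Obj C" "b \<in> Obj C" using assms by (auto simp: hom_iff)
  have "f \<cdot> runit a = g \<cdot> runit a"
    using runit_natural[of f] runit_natural[of g] assms by (auto simp: hom_iff)
  then show ?thesis
    by (rule iso_cancel_right) (use assms runit_iso in \<open>auto simp: hom_iff\<close>)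
qed

lemma triangle_runit:
  "\<lbrakk>a \<in> Obj C; b \<in> Obj C\<rbrakk> \<Longrightarrow> (runit a \<boxtimes> \<one> b) \<cdot> \<alpha> a \<I> b = \<one> a \<boxtimes> \<ell> b"
  by (simp add: runit_def triangle)

text \<open>
  Kelly's argument: the pentagon at \<open>(\<I>, \<I>, a, b)\<close>, followed by \<open>runit \<I>\<close> on its first factor, turns
  by the triangle into the equation with \<open>\<one> \<I>\<close> tensored on the left, which faithfulness removes.
\<close>

lemma lunit_tens:
  assumes [simp]: "a \<in> Obj C" "b \<in> Obj C"
  shows "(\<ell> a \<boxtimes> \<one> b) \<cdot> \<alpha> \<I> a b = \<ell> (a \<otimes> b)"
proof -
  let ?r = "(runit \<I> \<boxtimes> \<one> a) \<boxtimes> \<one> b"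
  have "\<alpha> \<I> a b \<cdot> (\<one> \<I> \<boxtimes> \<ell> (a \<otimes> b)) = \<alpha> \<I> a b \<cdot> (runit \<I> \<boxtimes> (\<one> a \<boxtimes> \<one> b)) \<cdot> \<alpha> \<I> \<I> (a \<otimes> b)"
    by (simp add: triangle_runit)
  also have "\<dots> = ?r \<cdot> \<alpha> (\<I> \<otimes> \<I>) a b \<cdot> \<alpha> \<I> \<I> (a \<otimes> b)"
    using reassoc[OF assoc_natural_arr[of "runit \<I>" "\<one> a" "\<one> b"], of "\<alpha> \<I> \<I> (a \<otimes> b)"] by simp
  also have "\<dots> = ?r \<cdot> (\<alpha> \<I> \<I> a \<boxtimes> \<one> b) \<cdot> \<alpha> \<I> (\<I> \<otimes> a) b \<cdot> (\<one> \<I> \<boxtimes> \<alpha> \<I> a b)"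
    by (simp add: pentagon)
  also have "\<dots> = ((\<one> \<I> \<boxtimes> \<ell> a) \<boxtimes> \<one> b) \<cdot> \<alpha> \<I> (\<I> \<otimes> a) b \<cdot> (\<one> \<I> \<boxtimes> \<alpha> \<I> a b)"
    by (simp add: interchange_reassoc triangle_runit)
  also have "\<dots> = \<alpha> \<I> a b \<cdot> (\<one> \<I> \<boxtimes> (\<ell> a \<boxtimes> \<one> b)) \<cdot> (\<one> \<I> \<boxtimes> \<alpha> \<I> a b)"
    by (subst reassoc[OF assoc_natural_arr[of "\<one> \<I>" "\<ell> a" "\<one> b", simplified]]) simp_all
  also have "\<dots> = \<alpha> \<I> a b \<cdot> (\<one> \<I> \<boxtimes> ((\<ell> a \<boxtimes> \<one> b) \<cdot> \<alpha> \<I> a b))"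
    by (simp add: interchange)
  finally have "\<one> \<I> \<boxtimes> \<ell> (a \<otimes> b) = \<one> \<I> \<boxtimes> ((\<ell> a \<boxtimes> \<one> b) \<cdot> \<alpha> \<I> a b)"
    by (rule iso_cancel_left) (simp_all add: assoc_iso)
  then show ?thesis
    by (rule lunit_faithful[symmetric]) (simp_all add: hom_iff)
qed

text \<open>The mirror image of the previous argument, from the pentagon at \<open>(a, b, \<I>, \<I>)\<close>.\<close>

lemma runit_tens:
  assumes [simp]: "a \<in> Obj C" "b \<in> Obj C"
  shows "runit (a \<otimes> b) \<cdot> \<alpha> a b \<I> = \<one> a \<boxtimes> runit b"
proof -
  let ?t = "\<one> a \<boxtimes> \<alpha> b \<I> \<I>"
  have iso_t: "is_iso C ?t"
    unfolding is_iso_def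
    by (rule exI[of _ "\<one> a \<boxtimes> inv_arr C (\<alpha> b \<I> \<I>)"])
      (simp add: inverse_arrows_def hom_iff interchange)
  have "((runit (a \<otimes> b) \<cdot> \<alpha> a b \<I>) \<boxtimes> \<one> \<I>) \<cdot> \<alpha> a (b \<otimes> \<I>) \<I> \<cdot> ?t
      = (runit (a \<otimes> b) \<boxtimes> \<one> \<I>) \<cdot> (\<alpha> a b \<I> \<boxtimes> \<one> \<I>) \<cdot> \<alpha> a (b \<otimes> \<I>) \<I> \<cdot> ?t"
    by (simp add: interchange_reassoc)
  also have "\<dots> = (runit (a \<otimes> b) \<boxtimes> \<one> \<I>) \<cdot> \<alpha> (a \<otimes> b) \<I> \<I> \<cdot> \<alpha> a b (\<I> \<otimes> \<I>)"
    by (simp add: pentagon)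
  also have "\<dots> = ((\<one> a \<boxtimes> \<one> b) \<boxtimes> \<ell> \<I>) \<cdot> \<alpha> a b (\<I> \<otimes> \<I>)"
    by (subst reassoc[OF triangle_runit]) simp_all
  also have "\<dots> = \<alpha> a b \<I> \<cdot> (\<one> a \<boxtimes> (\<one> b \<boxtimes> \<ell> \<I>))"
    by (subst assoc_natural_arr[of "\<one> a" "\<one> b" "\<ell> \<I>", simplified]) simp_all
  also have "\<dots> = \<alpha> a b \<I> \<cdot> (\<one> a \<boxtimes> (runit b \<boxtimes> \<one> \<I>)) \<cdot> ?t"
    by (simp add: interchange triangle_runit)
  also have "\<dots> = ((\<one> a \<boxtimes> runit b) \<boxtimes> \<one> \<I>) \<cdot> \<alpha> a (b \<otimes> \<I>) \<I> \<cdot> ?t"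
    by (subst reassoc[OF assoc_natural_arr[of "\<one> a" "runit b" "\<one> \<I>", simplified]]) simp_all
  finally have "(runit (a \<otimes> b) \<cdot> \<alpha> a b \<I>) \<boxtimes> \<one> \<I> = (\<one> a \<boxtimes> runit b) \<boxtimes> \<one> \<I>"
    by (rule iso_cancel_right) (simp_all add: is_iso_Comp assoc_iso iso_t)
  then show ?thesis
    by (rule runit_faithful) (simp_all add: hom_iff)
qed

text \<open>
  Naturality of \<open>\<ell>\<close> at \<open>\<ell> \<I>\<close> gives \<open>\<ell> (\<I> \<otimes> \<I>) = \<one> \<I> \<boxtimes> \<ell> \<I>\<close>.  Rewriting the left side by \<open>lunit_tens\<close>
  and the right side by the triangle leaves \<open>\<ell> \<I> \<boxtimes> \<one> \<I> = runit \<I> \<boxtimes> \<one> \<I>\<close>.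
\<close>

lemma runit_unit: "runit \<I> = \<ell> \<I>"
proof -
  have "\<ell> \<I> \<cdot> (\<one> \<I> \<boxtimes> \<ell> \<I>) = \<ell> \<I> \<cdot> \<ell> (\<I> \<otimes> \<I>)"
    by (rule lunit_natural) (simp add: hom_iff)
  then have "\<one> \<I> \<boxtimes> \<ell> \<I> = \<ell> (\<I> \<otimes> \<I>)"
    by (rule iso_cancel_left) (simp_all add: lunit_iso)
  then have "(runit \<I> \<boxtimes> \<one> \<I>) \<cdot> \<alpha> \<I> \<I> \<I> = (\<ell> \<I> \<boxtimes> \<one> \<I>) \<cdot> \<alpha> \<I> \<I> \<I>"
    by (simp add: triangle_runit lunit_tens)
  then have "runit \<I> \<boxtimes> \<one> \<I> = \<ell> \<I> \<boxtimes> \<one> \<I>"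
    by (rule iso_cancel_right) (simp_all add: assoc_iso)
  then show ?thesis
    by (rule runit_faithful) (simp_all add: hom_iff)
qed

end


section \<open>Sliding an arrow around the coevaluation\<close>

context compact_closed_category
begin

lemma dual_Obj [simp]: "a \<in> Obj C \<Longrightarrow> a\<star> \<in> Obj C"
  by (rule dual_in_Obj)

lemma arr_coev [simp]:
  assumes "a \<in> Obj C"
  shows "\<eta> a \<in> Arr C" "Dom C (\<eta> a) = \<I>" "Cod C (\<eta> a) = a\<star> \<otimes> a"
  using coev_in_hom[OF assms] by (auto simp: hom_iff)

lemma arr_ev [simp]:
  assumes "a \<in> Obj C"
  shows "\<epsilon> a \<in> Arr C" "Dom C (\<epsilon> a) = a \<otimes> a\<star>" "Cod C (\<epsilon> a) = \<I>"
  using ev_in_hom[OF assms] by (auto simp: hom_iff)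

text \<open>
  The snake identity with a spectator \<open>x\<close> on the left.  The pentagon moves the brackets so that the
  snake on \<open>b\<close> stands in the second factor, where it collapses to \<open>\<sigma> b \<I>\<close>; the unit laws do the rest.
\<close>

lemma snake_tens:
  assumes [simp]: "x \<in> Obj C" "b \<in> Obj C"
  shows "(runit x \<boxtimes> \<one> b) \<cdot> ((\<one> x \<boxtimes> \<epsilon> b) \<boxtimes> \<one> b) \<cdot> (inv_arr C (\<alpha> x b (b\<star>)) \<boxtimes> \<one> b)
      \<cdot> \<alpha> (x \<otimes> b) (b\<star>) b \<cdot> (\<one> (x \<otimes> b) \<boxtimes> \<eta> b)
    = runit (x \<otimes> b)"
proof -
  let ?A = "\<alpha> x b (b\<star>)" and ?A' = "inv_arr C (\<alpha> x b (b\<star> \<otimes> b))"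
  have pent: "(inv_arr C ?A \<boxtimes> \<one> b) \<cdot> \<alpha> (x \<otimes> b) (b\<star>) b
      = \<alpha> x (b \<otimes> b\<star>) b \<cdot> (\<one> x \<boxtimes> \<alpha> b (b\<star>) b) \<cdot> ?A'"
  proof -
    have "(inv_arr C ?A \<boxtimes> \<one> b) \<cdot> \<alpha> (x \<otimes> b) (b\<star>) b
        = (inv_arr C ?A \<boxtimes> \<one> b) \<cdot> (\<alpha> (x \<otimes> b) (b\<star>) b \<cdot> \<alpha> x b (b\<star> \<otimes> b)) \<cdot> ?A'"
      by simp
    also have "\<dots> = (inv_arr C ?A \<boxtimes> \<one> b) \<cdot> (?A \<boxtimes> \<one> b)
        \<cdot> \<alpha> x (b \<otimes> b\<star>) b \<cdot> (\<one> x \<boxtimes> \<alpha> b (b\<star>) b) \<cdot> ?A'"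
      by (subst pentagon) simp_all
    also have "\<dots> = \<alpha> x (b \<otimes> b\<star>) b \<cdot> (\<one> x \<boxtimes> \<alpha> b (b\<star>) b) \<cdot> ?A'"
      by (subst interchange_reassoc) simp_all
    finally show ?thesis .
  qed
  have inner: "((\<one> x \<boxtimes> \<epsilon> b) \<boxtimes> \<one> b) \<cdot> (inv_arr C ?A \<boxtimes> \<one> b)
      \<cdot> \<alpha> (x \<otimes> b) (b\<star>) b \<cdot> (\<one> (x \<otimes> b) \<boxtimes> \<eta> b)
    = \<alpha> x \<I> b \<cdot> (\<one> x \<boxtimes> \<sigma> b \<I>) \<cdot> inv_arr C (\<alpha> x b \<I>)"
  proof -
    have "((\<one> x \<boxtimes> \<epsilon> b) \<boxtimes> \<one> b) \<cdot> (inv_arr C ?A \<boxtimes> \<one> b)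
        \<cdot> \<alpha> (x \<otimes> b) (b\<star>) b \<cdot> (\<one> (x \<otimes> b) \<boxtimes> \<eta> b)
      = ((\<one> x \<boxtimes> \<epsilon> b) \<boxtimes> \<one> b) \<cdot> \<alpha> x (b \<otimes> b\<star>) b \<cdot> (\<one> x \<boxtimes> \<alpha> b (b\<star>) b)
        \<cdot> ?A' \<cdot> ((\<one> x \<boxtimes> \<one> b) \<boxtimes> \<eta> b)"
      by (subst reassoc[OF pent]) simp_all
    also have "\<dots> = ((\<one> x \<boxtimes> \<epsilon> b) \<boxtimes> \<one> b) \<cdot> \<alpha> x (b \<otimes> b\<star>) b \<cdot> (\<one> x \<boxtimes> \<alpha> b (b\<star>) b)
        \<cdot> (\<one> x \<boxtimes> (\<one> b \<boxtimes> \<eta> b)) \<cdot> inv_arr C (\<alpha> x b \<I>)"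
      using inv_assoc_natural[of "\<one> x" "\<one> b" "\<eta> b"] by simp
    also have "\<dots> = \<alpha> x \<I> b \<cdot> (\<one> x \<boxtimes> (\<epsilon> b \<boxtimes> \<one> b)) \<cdot> (\<one> x \<boxtimes> \<alpha> b (b\<star>) b)
        \<cdot> (\<one> x \<boxtimes> (\<one> b \<boxtimes> \<eta> b)) \<cdot> inv_arr C (\<alpha> x b \<I>)"
      using reassoc[OF assoc_natural_arr[of "\<one> x" "\<epsilon> b" "\<one> b", simplified],
          of "(\<one> x \<boxtimes> \<alpha> b (b\<star>) b) \<cdot> (\<one> x \<boxtimes> (\<one> b \<boxtimes> \<eta> b)) \<cdot> inv_arr C (\<alpha> x b \<I>)"]
      by simp
    also have "\<dots> = \<alpha> x \<I> b \<cdot> (\<one> x \<boxtimes> \<sigma> b \<I>) \<cdot> inv_arr C (\<alpha> x b \<I>)"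
      by (simp add: interchange_reassoc snake)
    finally show ?thesis .
  qed
  have "(runit x \<boxtimes> \<one> b) \<cdot> \<alpha> x \<I> b \<cdot> (\<one> x \<boxtimes> \<sigma> b \<I>) \<cdot> inv_arr C (\<alpha> x b \<I>)
      = (\<one> x \<boxtimes> \<ell> b) \<cdot> (\<one> x \<boxtimes> \<sigma> b \<I>) \<cdot> inv_arr C (\<alpha> x b \<I>)"
    by (subst reassoc[OF triangle_runit]) simp_all
  also have "\<dots> = (\<one> x \<boxtimes> runit b) \<cdot> inv_arr C (\<alpha> x b \<I>)"
    by (subst interchange_reassoc) (simp_all add: runit_def)
  also have "\<dots> = runit (x \<otimes> b)"
    by (simp flip: runit_tens)
  finally show ?thesis by (simp add: inner)
qed

text \<open>
  By duality \<open>h \<mapsto> (h \<boxtimes> \<one> b) \<cdot> \<eta> b\<close> maps the arrows \<open>b\<star> \<rightarrow> x\<close> onto the arrows \<open>\<I> \<rightarrow> x \<otimes> b\<close>; the arrow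
  built here from \<open>n\<close> is the explicit preimage.  Interchange lets \<open>\<eta> b\<close> act after \<open>n\<close> instead of before
  it, so that the snake of \<open>snake_tens\<close> stands between \<open>n\<close> and the codomain and collapses.
\<close>

lemma unname_coev:
  assumes "n \<in> hom C \<I> (x \<otimes> b)" and [simp]: "x \<in> Obj C" "b \<in> Obj C"
  shows "((runit x \<cdot> (\<one> x \<boxtimes> \<epsilon> b) \<cdot> inv_arr C (\<alpha> x b (b\<star>)) \<cdot> (n \<boxtimes> \<one> (b\<star>)) \<cdot> inv_arr C (\<ell> (b\<star>)))
      \<boxtimes> \<one> b) \<cdot> \<eta> b = n"
    (is "(?h \<boxtimes> _) \<cdot> _ = _")
proof -
  have [simp]: "n \<in> Arr C" "Dom C n = \<I>" "Cod C n = x \<otimes> b"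
    using assms(1) by (auto simp: hom_iff)
  let ?s = "(runit x \<boxtimes> \<one> b) \<cdot> ((\<one> x \<boxtimes> \<epsilon> b) \<boxtimes> \<one> b) \<cdot> (inv_arr C (\<alpha> x b (b\<star>)) \<boxtimes> \<one> b)"
  have unit: "(inv_arr C (\<ell> (b\<star>)) \<boxtimes> \<one> b) \<cdot> \<eta> b
      = \<alpha> \<I> (b\<star>) b \<cdot> (\<one> \<I> \<boxtimes> \<eta> b) \<cdot> inv_arr C (\<ell> \<I>)"
  proof -
    have "(\<ell> (b\<star>) \<boxtimes> \<one> b) \<cdot> \<alpha> \<I> (b\<star>) b \<cdot> inv_arr C (\<ell> (b\<star> \<otimes> b)) = \<one> (b\<star> \<otimes> b)"
      by (subst reassoc[OF lunit_tens]) simp_all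
    then have "(inv_arr C (\<ell> (b\<star>)) \<boxtimes> \<one> b)
        = (inv_arr C (\<ell> (b\<star>)) \<boxtimes> \<one> b) \<cdot> (\<ell> (b\<star>) \<boxtimes> \<one> b) \<cdot> \<alpha> \<I> (b\<star>) b \<cdot> inv_arr C (\<ell> (b\<star> \<otimes> b))"
      by simp
    also have "\<dots> = \<alpha> \<I> (b\<star>) b \<cdot> inv_arr C (\<ell> (b\<star> \<otimes> b))"
      by (subst interchange_reassoc) simp_all
    finally show ?thesis
      using inv_lunit_natural[of "\<eta> b"] by simp
  qed
  have "(?h \<boxtimes> \<one> b) \<cdot> \<eta> b
      = ?s \<cdot> ((n \<boxtimes> \<one> (b\<star>)) \<boxtimes> \<one> b) \<cdot> (inv_arr C (\<ell> (b\<star>)) \<boxtimes> \<one> b) \<cdot> \<eta> b"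
    by (simp add: interchange_reassoc)
  also have "\<dots> = ?s \<cdot> ((n \<boxtimes> \<one> (b\<star>)) \<boxtimes> \<one> b) \<cdot> \<alpha> \<I> (b\<star>) b \<cdot> (\<one> \<I> \<boxtimes> \<eta> b) \<cdot> inv_arr C (\<ell> \<I>)"
    by (simp add: unit)
  also have "\<dots> = ?s \<cdot> \<alpha> (x \<otimes> b) (b\<star>) b \<cdot> (n \<boxtimes> (\<one> (b\<star>) \<boxtimes> \<one> b))
      \<cdot> (\<one> \<I> \<boxtimes> \<eta> b) \<cdot> inv_arr C (\<ell> \<I>)"
    using reassoc[OF assoc_natural_arr[of n "\<one> (b\<star>)" "\<one> b", simplified],
        of "(\<one> \<I> \<boxtimes> \<eta> b) \<cdot> inv_arr C (\<ell> \<I>)"]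
    by simp
  also have "\<dots> = ?s \<cdot> \<alpha> (x \<otimes> b) (b\<star>) b \<cdot> (\<one> (x \<otimes> b) \<boxtimes> \<eta> b) \<cdot> (n \<boxtimes> \<one> \<I>) \<cdot> inv_arr C (\<ell> \<I>)"
    by (simp add: interchange_reassoc)
  also have "\<dots> = (?s \<cdot> \<alpha> (x \<otimes> b) (b\<star>) b \<cdot> (\<one> (x \<otimes> b) \<boxtimes> \<eta> b)) \<cdot> (n \<boxtimes> \<one> \<I>) \<cdot> inv_arr C (\<ell> \<I>)"
    by simp
  also have "\<dots> = runit (x \<otimes> b) \<cdot> (n \<boxtimes> \<one> \<I>) \<cdot> inv_arr C (\<ell> \<I>)"
    using snake_tens[of x b] by simp
  also have "\<dots> = n \<cdot> runit \<I> \<cdot> inv_arr C (\<ell> \<I>)"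
    using reassoc[OF runit_natural[of n], of "inv_arr C (\<ell> \<I>)"] by simp
  also have "\<dots> = n"
    by (simp add: runit_unit)
  finally show ?thesis .
qed

text \<open>The transpose of \<open>g\<close> is the preimage, in the above sense, of the name of \<open>g\<close>.\<close>

lemma upper_star_coev:
  assumes "g \<in> hom C a b"
  shows "upper_star C g \<in> hom C (b\<star>) (a\<star>)"
    and "(upper_star C g \<boxtimes> \<one> b) \<cdot> \<eta> b = (\<one> (a\<star>) \<boxtimes> g) \<cdot> \<eta> a"
proof -
  have [simp]: "g \<in> Arr C" "Dom C g = a" "Cod C g = b" "a \<in> Obj C" "b \<in> Obj C"
    using assms by (auto simp: hom_iff)
  have eq: "upper_star C g = runit (a\<star>) \<cdot> (\<one> (a\<star>) \<boxtimes> \<epsilon> b) \<cdot> inv_arr C (\<alpha> (a\<star>) b (b\<star>))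
      \<cdot> (((\<one> (a\<star>) \<boxtimes> g) \<cdot> \<eta> a) \<boxtimes> \<one> (b\<star>)) \<cdot> inv_arr C (\<ell> (b\<star>))"
    by (simp add: upper_star_def Let_def runit_def interchange_reassoc)
  show "upper_star C g \<in> hom C (b\<star>) (a\<star>)"
    by (simp add: eq hom_iff)
  show "(upper_star C g \<boxtimes> \<one> b) \<cdot> \<eta> b = (\<one> (a\<star>) \<boxtimes> g) \<cdot> \<eta> a"
    unfolding eq by (rule unname_coev) (simp_all add: hom_iff)
qed

text \<open>
  The arrow \<open>g\<close>, encoded on the dual half of the pair \<open>\<eta> a\<close>, reappears on the other half; after the
  swap it stands directly before \<open>f\<close>, and closing with \<open>\<epsilon> a\<close> gives a trace.
\<close>

lemma coname_upper_star_coev: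
  assumes "f \<in> hom C a a" "g \<in> hom C a a"
  shows "coname C f \<cdot> \<sigma> (a\<star>) a \<cdot> (upper_star C g \<boxtimes> \<one> a) \<cdot> \<eta> a = Tr C (f \<cdot> g)"
proof -
  have [simp]: "f \<in> Arr C" "Dom C f = a" "Cod C f = a" "g \<in> Arr C" "Dom C g = a" "Cod C g = a"
      "a \<in> Obj C"
    using assms by (auto simp: hom_iff)
  have s: "\<sigma> (a\<star>) a \<cdot> (\<one> (a\<star>) \<boxtimes> g) = (g \<boxtimes> \<one> (a\<star>)) \<cdot> \<sigma> (a\<star>) a"
    by (rule swap_natural) (simp_all add: hom_iff)
  have "\<sigma> (a\<star>) a \<cdot> (upper_star C g \<boxtimes> \<one> a) \<cdot> \<eta> a = (g \<boxtimes> \<one> (a\<star>)) \<cdot> \<sigma> (a\<star>) a \<cdot> \<eta> a"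
    using reassoc[OF s, of "\<eta> a"] by (simp add: upper_star_coev[OF assms(2)])
  then show ?thesis
    by (simp add: coname_def Tr_def Let_def interchange_reassoc)
qed

end


section \<open>Components of arrows into biproducts\<close>

context biproduct_category
begin

lemma tuple_component:
  assumes "a \<in> Obj C" "c \<in> Obj C" "\<And>i. i \<in> {1..n} \<Longrightarrow> f i \<in> hom C c a"
  shows "tuple C n c a f \<in> hom C c (nfold C n a)"
    and "i \<in> {1..n} \<Longrightarrow> nprj C n a i \<cdot> tuple C n c a f = f i"
  using theI'[OF tuple_ex1[where f = f, OF assms]] unfolding tuple_def by blast+

lemma bipA_prj:
  assumes "f \<in> hom C a b" "g \<in> hom C c d"
  shows "bipA C f g \<in> hom C (a \<oplus> c) (b \<oplus> d)"
    and "prj1 C b d \<cdot> bipA C f g = f \<cdot> prj1 C a c"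
    and "prj2 C b d \<cdot> bipA C f g = g \<cdot> prj2 C a c"
proof -
  have *: "f \<in> Arr C" "g \<in> Arr C" "Dom C f = a" "Cod C f = b" "Dom C g = c" "Cod C g = d"
    using assms by (auto simp: hom_iff)
  show "bipA C f g \<in> hom C (a \<oplus> c) (b \<oplus> d)"
    and "prj1 C b d \<cdot> bipA C f g = f \<cdot> prj1 C a c"
    and "prj2 C b d \<cdot> bipA C f g = g \<cdot> prj2 C a c"
    using theI'[OF bipA_ex1[OF *(1,2)]] unfolding bipA_def *(3-) by blast+
qed

lemma nfoldA_in_hom:
  assumes "f \<in> hom C a b"
  shows "nfoldA C n f \<in> hom C (nfold C n a) (nfold C n b)"
proof (induction n)
  case 0
  then show ?case by (simp add: Ident_in_hom zero_in_Obj)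
next
  case (Suc n)
  then show ?case using assms by (cases n) (auto intro: bipA_prj)
qed

lemma nprj_nfoldA:
  assumes f: "f \<in> hom C a b" and "i \<in> {1..n}"
  shows "nprj C n b i \<cdot> nfoldA C n f = f \<cdot> nprj C n a i"
  using assms(2)
proof (induction n)
  case (Suc n)
  have [simp]: "f \<in> Arr C" "Dom C f = a" "Cod C f = b" and ab: "a \<in> Obj C" "b \<in> Obj C"
    using f Dom_in_Obj Cod_in_Obj by (auto simp: hom_iff)
  show ?case
  proof (cases n)
    case 0
    then show ?thesis by (simp add: ab)
  next
    case (Suc m)
    let ?a = "nfold C n a" and ?b = "nfold C n b" and ?F = "nfoldA C n f"
    have F: "?F \<in> hom C ?a ?b" by (rule nfoldA_in_hom[OF f])
    show ?thesis
    proof (cases "i = Suc n")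
      case True
      then show ?thesis using bipA_prj(3)[OF F f] Suc by simp
    next
      case False
      then have i: "i \<in> {1..n}" using Suc.prems by auto
      have p: "prj1 C ?a a \<in> hom C (?a \<oplus> a) ?a" "prj1 C ?b b \<in> hom C (?b \<oplus> b) ?b"
        by (simp_all add: prj1_in_hom nfold_in_Obj ab)
      have "(nprj C n b i \<cdot> prj1 C ?b b) \<cdot> bipA C ?F f = nprj C n b i \<cdot> prj1 C ?b b \<cdot> bipA C ?F f"
        by (rule Comp_assoc[OF bipA_prj(1)[OF F f] p(2) nprj_in_hom[OF ab(2) i]])
      also have "\<dots> = (nprj C n b i \<cdot> ?F) \<cdot> prj1 C ?a a"
        using Comp_assoc[OF p(1) F nprj_in_hom[OF ab(2) i]] bipA_prj(2)[OF F f] by simp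
      also have "\<dots> = f \<cdot> nprj C n a i \<cdot> prj1 C ?a a"
        using Comp_assoc[OF p(1) nprj_in_hom[OF ab(1) i] f] Suc.IH[OF i] by simp
      finally show ?thesis using False Suc by simp
    qed
  qed
qed simp

lemma tuple2_eqI:
  assumes "a \<in> Obj C" "h \<in> hom C c (nfold C (m * n) a)"
    and "\<And>i j. \<lbrakk>i \<in> {1..m}; j \<in> {1..n}\<rbrakk> \<Longrightarrow> nprj C (m * n) a (n * (i - 1) + j) \<cdot> h = f i j"
    and "\<And>i j. \<lbrakk>i \<in> {1..m}; j \<in> {1..n}\<rbrakk> \<Longrightarrow> f i j \<in> hom C c a"
  shows "h = tuple2 C m n c a f"
proof -
  have c: "c \<in> Obj C" using assms(2) Dom_in_Obj by (auto simp: hom_iff)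
  show ?thesis
    unfolding tuple2_def
    by (rule the1_equality[symmetric, OF tuple2_ex1[where f = f, OF assms(1) c assms(4)]])
      (use assms(2,3) in auto)
qed

lemma flatten_component:
  assumes a: "a \<in> Obj C"
  shows "flatten C m n a \<in> hom C (nfold C m (nfold C n a)) (nfold C (m * n) a)"
    and "\<lbrakk>i \<in> {1..m}; j \<in> {1..n}\<rbrakk>
      \<Longrightarrow> nprj C (m * n) a (n * (i - 1) + j) \<cdot> flatten C m n a
        = nprj C n a j \<cdot> nprj C m (nfold C n a) i"
proof -
  have "nprj C n a j \<cdot> nprj C m (nfold C n a) i \<in> hom C (nfold C m (nfold C n a)) a"
    if "i \<in> {1..m}" "j \<in> {1..n}" for i j
    by (intro Comp_in_hom[of _ _ "nfold C n a"] nprj_in_hom that a nfold_in_Obj)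
  note * = theI'[OF tuple2_ex1[where f = "\<lambda>i j. nprj C n a j \<cdot> nprj C m (nfold C n a) i",
        OF a nfold_in_Obj[OF nfold_in_Obj[OF a]] this]]
  show "flatten C m n a \<in> hom C (nfold C m (nfold C n a)) (nfold C (m * n) a)"
    and "\<lbrakk>i \<in> {1..m}; j \<in> {1..n}\<rbrakk>
      \<Longrightarrow> nprj C (m * n) a (n * (i - 1) + j) \<cdot> flatten C m n a
        = nprj C n a j \<cdot> nprj C m (nfold C n a) i"
    using * unfolding flatten_def tuple2_def by blast+
qed

end


section \<open>The superdense coding protocol\<close>

context dagger_compact_closed_category_with_dagger_biproducts
begin

lemma distrib_component:
  assumes [simp]: "a \<in> Obj C" "b \<in> Obj C"
  shows "\<upsilon> n a b \<in> hom C (nfold C n a \<otimes> b) (nfold C n (a \<otimes> b))"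
    and "i \<in> {1..n} \<Longrightarrow> nprj C n (a \<otimes> b) i \<cdot> \<upsilon> n a b = nprj C n a i \<boxtimes> \<one> b"
proof -
  have "nprj C n a i \<boxtimes> \<one> b \<in> hom C (nfold C n a \<otimes> b) (a \<otimes> b)" if "i \<in> {1..n}" for i
    by (intro tensA_in_hom nprj_in_hom Ident_in_hom that) simp_all
  then show "\<upsilon> n a b \<in> hom C (nfold C n a \<otimes> b) (nfold C n (a \<otimes> b))"
    and "i \<in> {1..n} \<Longrightarrow> nprj C n (a \<otimes> b) i \<cdot> \<upsilon> n a b = nprj C n a i \<boxtimes> \<one> b"
    unfolding distrib_def
    using tuple_component[of "a \<otimes> b" "nfold C n a \<otimes> b" n "\<lambda>i. nprj C n a i \<boxtimes> \<one> b"]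
    by (auto simp: nfold_in_Obj)
qed

text \<open>
  Each stage of the protocol acts on components separately, so the component at sender's choice \<open>i\<close>
  and measurement outcome \<open>j\<close> is a single closed loop through \<open>(f i)\<^sup>\<dagger>\<close> and then \<open>g j\<close>.
\<close>

lemma superdense_components:
  assumes Q [simp]: "Q \<in> Obj C"
    and f: "\<And>i. i \<in> {1..m} \<Longrightarrow> f i \<in> hom C Q Q" and g: "\<And>j. j \<in> {1..n} \<Longrightarrow> g j \<in> hom C Q Q"
  shows "flatten C m n \<I>
      \<cdot> nfoldA C m (tuple C n (Q \<otimes> Q\<star>) \<I> (\<lambda>j. coname C (g j)))
      \<cdot> (nfoldA C m (\<sigma> (Q\<star>) Q) \<cdot> \<upsilon> m (Q\<star>) Q)
      \<cdot> (tuple C m (Q\<star>) (Q\<star>) (\<lambda>i. lower_star C (f i)) \<boxtimes> \<one> Q)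
      \<cdot> name C (\<one> Q)
    = tuple2 C m n \<I> \<I> (\<lambda>i j. Tr C (g j \<cdot> (f i)\<dagger>))"
    (is "?F \<cdot> ?M \<cdot> (?S \<cdot> ?U) \<cdot> (?L \<boxtimes> _) \<cdot> _ = _")
proof -
  let ?t = "tuple C n (Q \<otimes> Q\<star>) \<I> (\<lambda>j. coname C (g j))"
  have name [simp]: "name C (\<one> Q) = \<eta> Q"
    by (simp add: name_def)
  have ls: "lower_star C (f i) \<in> hom C (Q\<star>) (Q\<star>)" if "i \<in> {1..m}" for i
    unfolding lower_star_def by (intro upper_star_coev dagger_in_hom f that)
  have cn: "coname C (g j) \<in> hom C (Q \<otimes> Q\<star>) \<I>" if "j \<in> {1..n}" for j
    using g[OF that] by (auto simp: coname_def hom_iff)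
  note t = tuple_component[of \<I> "Q \<otimes> Q\<star>" n "\<lambda>j. coname C (g j)", OF _ _ cn, simplified]
  note L = tuple_component[of "Q\<star>" "Q\<star>" m "\<lambda>i. lower_star C (f i)", OF _ _ ls, simplified]
  have [simp]: "nfold C k a \<in> Obj C" if "a \<in> Obj C" for k a
    by (rule nfold_in_Obj[OF that])
  have arrs [simp]:
    "?F \<in> Arr C" "Dom C ?F = nfold C m (nfold C n \<I>)" "Cod C ?F = nfold C (m * n) \<I>"
    "?M \<in> Arr C" "Dom C ?M = nfold C m (Q \<otimes> Q\<star>)" "Cod C ?M = nfold C m (nfold C n \<I>)"
    "?S \<in> Arr C" "Dom C ?S = nfold C m (Q\<star> \<otimes> Q)" "Cod C ?S = nfold C m (Q \<otimes> Q\<star>)"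
    "?U \<in> Arr C" "Dom C ?U = nfold C m (Q\<star>) \<otimes> Q" "Cod C ?U = nfold C m (Q\<star> \<otimes> Q)"
    "?L \<in> Arr C" "Dom C ?L = Q\<star>" "Cod C ?L = nfold C m (Q\<star>)"
    "?t \<in> Arr C" "Dom C ?t = Q \<otimes> Q\<star>" "Cod C ?t = nfold C n \<I>"
    using flatten_component(1)[of \<I> m n] nfoldA_in_hom[OF t(1), of m]
      nfoldA_in_hom[OF swap_in_hom[of "Q\<star>" Q], of m] distrib_component(1)[of "Q\<star>" Q m] L(1) t(1)
    by (simp_all add: hom_iff)
  have nprj [simp]: "nprj C k a i \<in> Arr C" "Dom C (nprj C k a i) = nfold C k a"
      "Cod C (nprj C k a i) = a" if "a \<in> Obj C" "i \<in> {1..k}" for k a i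
    using nprj_in_hom[OF that] by (auto simp: hom_iff)
  show ?thesis
  proof (rule tuple2_eqI)
    fix i j assume i: "i \<in> {1..m}" and j: "j \<in> {1..n}"
    have [simp]: "lower_star C (f i) \<in> Arr C" "Dom C (lower_star C (f i)) = Q\<star>"
        "Cod C (lower_star C (f i)) = Q\<star>"
      using ls[OF i] by (auto simp: hom_iff)
    have idx: "i \<in> {1..m}" "j \<in> {1..n}" "n * (i - 1) + j \<in> {1..m * n}"
    proof -
      have "n * (i - 1) + j \<le> n * (i - 1) + n" using j by simp
      also have "\<dots> = n * i" using i by (cases i) simp_all
      also have "\<dots> \<le> m * n" using i by (simp add: mult.commute)
      finally show "n * (i - 1) + j \<in> {1..m * n}" using j by simp
    qed (fact i j)+
    note [simp] = nprj[OF _ idx(1)] nprj[OF _ idx(2)] nprj[OF _ idx(3), unfolded One_nat_def]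
    let ?X = "(?S \<cdot> ?U) \<cdot> (?L \<boxtimes> \<one> Q) \<cdot> \<eta> Q"
    have "nprj C m (Q \<otimes> Q\<star>) i \<cdot> ?X
        = (\<sigma> (Q\<star>) Q \<cdot> nprj C m (Q\<star> \<otimes> Q) i) \<cdot> ?U \<cdot> (?L \<boxtimes> \<one> Q) \<cdot> \<eta> Q"
      using reassoc[OF nprj_nfoldA[OF swap_in_hom[of "Q\<star>" Q] i], of "?U \<cdot> (?L \<boxtimes> \<one> Q) \<cdot> \<eta> Q"]
      by simp
    also have "\<dots> = \<sigma> (Q\<star>) Q \<cdot> (nprj C m (Q\<star>) i \<boxtimes> \<one> Q) \<cdot> (?L \<boxtimes> \<one> Q) \<cdot> \<eta> Q"
      using reassoc[OF distrib_component(2)[of "Q\<star>" Q, OF _ _ i], of "(?L \<boxtimes> \<one> Q) \<cdot> \<eta> Q"]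
      by simp
    also have "\<dots> = \<sigma> (Q\<star>) Q \<cdot> (lower_star C (f i) \<boxtimes> \<one> Q) \<cdot> \<eta> Q"
      using L(2)[of i] i by (simp add: interchange_reassoc)
    finally have X: "nprj C m (Q \<otimes> Q\<star>) i \<cdot> ?X = \<sigma> (Q\<star>) Q \<cdot> (lower_star C (f i) \<boxtimes> \<one> Q) \<cdot> \<eta> Q" .
    have "nprj C (m * n) \<I> (n * (i - 1) + j) \<cdot> ?F \<cdot> ?M \<cdot> ?X
        = (nprj C n \<I> j \<cdot> nprj C m (nfold C n \<I>) i) \<cdot> ?M \<cdot> ?X"
      using reassoc[OF flatten_component(2)[OF unit_in_Obj i j], of "?M \<cdot> ?X"] by simp
    also have "\<dots> = nprj C n \<I> j \<cdot> ?t \<cdot> nprj C m (Q \<otimes> Q\<star>) i \<cdot> ?X"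
      using reassoc[OF nprj_nfoldA[OF t(1) i], of ?X] by simp
    also have "\<dots> = coname C (g j) \<cdot> \<sigma> (Q\<star>) Q \<cdot> (lower_star C (f i) \<boxtimes> \<one> Q) \<cdot> \<eta> Q"
      unfolding X using j by (subst reassoc[OF t(2)]) simp_all
    also have "\<dots> = Tr C (g j \<cdot> (f i)\<dagger>)"
      unfolding lower_star_def by (rule coname_upper_star_coev[OF g[OF j] dagger_in_hom[OF f[OF i]]])
    finally show "nprj C (m * n) \<I> (n * (i - 1) + j)
        \<cdot> ?F \<cdot> ?M \<cdot> (?S \<cdot> ?U) \<cdot> (?L \<boxtimes> \<one> Q) \<cdot> name C (\<one> Q) = Tr C (g j \<cdot> (f i)\<dagger>)"
      by simp
    show "Tr C (g j \<cdot> (f i)\<dagger>) \<in> hom C \<I> \<I>"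
      using g[OF j] dagger_in_hom[OF f[OF i]] by (auto simp: Tr_def Let_def hom_iff)
  qed (simp_all add: hom_iff)
qed

end

theorem mainTheorem5:
  fixes C :: "('o, 'm, 'x) biproduct_data_scheme" (structure)
    and Q :: 'o and \<beta> :: "nat \<Rightarrow> 'm"
  assumes "dagger_compact_closed_category_with_dagger_biproducts C"
    and "Q \<in> Obj C"
    and "\<forall>i\<in>{1..4}. \<beta> i \<in> hom C Q Q \<and> unitary C (\<beta> i)"
    and "\<forall>i\<in>{1..4}. \<forall>j\<in>{1..4}. i \<noteq> j \<longrightarrow> Tr C (\<beta> i \<cdot> (\<beta> j)\<dagger>) = zero_arr C \<I> \<I>"
    and "Tr C (\<one> Q) \<noteq> zero_arr C \<I> \<I>"
  shows "flatten C 4 4 \<I>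
         \<cdot> nfoldA C 4 (tuple C 4 (Q \<otimes> Q\<star>) \<I> (\<lambda>j. coname C (\<beta> j)))
         \<cdot> (nfoldA C 4 (\<sigma> (Q\<star>) Q) \<cdot> \<upsilon> 4 (Q\<star>) Q)
         \<cdot> (tuple C 4 (Q\<star>) (Q\<star>) (\<lambda>i. lower_star C (\<beta> i)) \<boxtimes> \<one> Q)
         \<cdot> name C (\<one> Q)
       = tuple2 C 4 4 \<I> \<I> (\<lambda>i j. Tr C (\<beta> i \<cdot> (\<beta> j)\<dagger>))"
proof -
  interpret dagger_compact_closed_category_with_dagger_biproducts C by (rule assms(1))
  \<comment> \<open>The loop at position \<open>(i, j)\<close> reads \<open>\<beta> j \<cdot> (\<beta> i)\<dagger>\<close>, with the indices the other way round; off the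
    diagonal both traces vanish.\<close>
  have sym: "Tr C (\<beta> j \<cdot> (\<beta> i)\<dagger>) = Tr C (\<beta> i \<cdot> (\<beta> j)\<dagger>)" if "i \<in> {1..4}" "j \<in> {1..4}" for i j
    using assms(4) that by (cases "i = j") auto
  have "tuple2 C 4 4 \<I> \<I> (\<lambda>i j. Tr C (\<beta> j \<cdot> (\<beta> i)\<dagger>)) = tuple2 C 4 4 \<I> \<I> (\<lambda>i j. Tr C (\<beta> i \<cdot> (\<beta> j)\<dagger>))"
    unfolding tuple2_def by (simp add: sym)
  then show ?thesis
    using superdense_components[of Q 4 \<beta> 4 \<beta>, OF assms(2)] assms(3) by simp
qed

end
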